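(* Let $d$ be even and let $f$ be a homogeneous multilinear $n$-variate polynomial of degree $d$ with non-negative coefficients. Then \[\frac{\Lambda(f)}{\|f\|_2}\le2^{O(d)}\,\frac{n^{d/4}}{d^{d/4}}.\]
   Context: $\|f\|_2:=\sup_{\|x\|_2=1}|f(x)|$. Multilinear means every monomial with non-zero coefficient has all exponents at most 1. A matrix representation of $f$ is a symmetric $M\in\mathbb{R}^{[n]^{d/2}\times[n]^{d/2}}$ with $(x^{\otimes d/2})^TMx^{\otimes d/2}=f(x)$ for all $x$, and $\Lambda(f):=\inf\{\sup_{\|z\|_2=1}z^TMz:\ M\text{ a matrix representation of }f\}$. *)

theory Defs
  imports "HOL-Analysis.Analysis" "HOL-Library.Poly_Mapping"
begin

text \<open>
  Real polynomials in the variables \<open>x\<^sub>0, x\<^sub>1, \<dots>\<close>: a finitely supported map from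
  monomials (finitely supported exponent vectors) to coefficients. A point of real \<open>n\<close>-space
  is a function \<open>x :: nat \<Rightarrow> real\<close> of which only the values on \<open>{..<n}\<close> matter, and likewise
  a vector or matrix indexed by a finite set \<open>I\<close> is a function of which only the values
  on \<open>I\<close> matter. The dimension is not a type because the constant in the bound is uniform in it.
\<close>

type_synonym rpoly = "(nat \<Rightarrow>\<^sub>0 nat) \<Rightarrow>\<^sub>0 real"

abbreviation coeff :: "rpoly \<Rightarrow> (nat \<Rightarrow>\<^sub>0 nat) \<Rightarrow> real" where
  "coeff f m \<equiv> Poly_Mapping.lookup f m"

abbreviation expo :: "(nat \<Rightarrow>\<^sub>0 nat) \<Rightarrow> nat \<Rightarrow> nat" where
  "expo m i \<equiv> Poly_Mapping.lookup m i"

definition eval_poly :: "rpoly \<Rightarrow> (nat \<Rightarrow> real) \<Rightarrow> real" where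
  "eval_poly f x =
     (\<Sum>m\<in>Poly_Mapping.keys f. coeff f m * (\<Prod>i\<in>Poly_Mapping.keys m. x i ^ expo m i))"

definition variate :: "nat \<Rightarrow> rpoly \<Rightarrow> bool" where
  "variate n f \<longleftrightarrow> (\<forall>m\<in>Poly_Mapping.keys f. Poly_Mapping.keys m \<subseteq> {..<n})"

definition homogeneous :: "nat \<Rightarrow> rpoly \<Rightarrow> bool" where
  "homogeneous d f \<longleftrightarrow>
     (\<forall>m\<in>Poly_Mapping.keys f. (\<Sum>i\<in>Poly_Mapping.keys m. expo m i) = d)"

definition multilinear :: "rpoly \<Rightarrow> bool" where
  "multilinear f \<longleftrightarrow> (\<forall>m\<in>Poly_Mapping.keys f. \<forall>i. expo m i \<le> 1)"

definition nonneg_coeffs :: "rpoly \<Rightarrow> bool" where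
  "nonneg_coeffs f \<longleftrightarrow> (\<forall>m. 0 \<le> coeff f m)"

definition unit_sphere :: "'i set \<Rightarrow> ('i \<Rightarrow> real) set" where
  "unit_sphere I = {x. L2_set x I = 1}"

definition norm2 :: "nat \<Rightarrow> rpoly \<Rightarrow> real" where
  "norm2 n f = (SUP x\<in>unit_sphere {..<n}. \<bar>eval_poly f x\<bar>)"

definition multi_indices :: "nat \<Rightarrow> nat \<Rightarrow> (nat \<Rightarrow> nat) set" where
  "multi_indices n k = {..<k} \<rightarrow>\<^sub>E {..<n}"

definition tensor_power :: "nat \<Rightarrow> (nat \<Rightarrow> real) \<Rightarrow> (nat \<Rightarrow> nat) \<Rightarrow> real" where
  "tensor_power k x a = (\<Prod>j<k. x (a j))"

definition quad_form :: "'i set \<Rightarrow> ('i \<Rightarrow> 'i \<Rightarrow> real) \<Rightarrow> ('i \<Rightarrow> real) \<Rightarrow> real" where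
  "quad_form I M z = (\<Sum>a\<in>I. \<Sum>b\<in>I. z a * M a b * z b)"

definition matrix_rep ::
  "nat \<Rightarrow> nat \<Rightarrow> rpoly \<Rightarrow> ((nat \<Rightarrow> nat) \<Rightarrow> (nat \<Rightarrow> nat) \<Rightarrow> real) \<Rightarrow> bool" where
  "matrix_rep n d f M \<longleftrightarrow>
     (\<forall>a\<in>multi_indices n (d div 2). \<forall>b\<in>multi_indices n (d div 2). M a b = M b a) \<and>
     (\<forall>x. quad_form (multi_indices n (d div 2)) M (tensor_power (d div 2) x) = eval_poly f x)"

definition Lambda :: "nat \<Rightarrow> nat \<Rightarrow> rpoly \<Rightarrow> real" where
  "Lambda n d f =
     (INF M\<in>{M. matrix_rep n d f M}.
        SUP z\<in>unit_sphere (multi_indices n (d div 2)). quad_form (multi_indices n (d div 2)) M z)"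

end

(*
  Spread each coefficient of f evenly over all entries (a, b) whose product monomial carries it.
  The resulting matrix M is symmetric, non-negative, and its entries depend only on the monomials
  of a and b. By the Schur test its largest eigenvalue is at most its maximal row sum. A row a with
  a repeated index vanishes by multilinearity. For the row of an injective a put k = d/2 and evaluate
  f at x = 1_a / sqrt k + 1 / sqrt n, a vector of norm at most 2: the k! rearrangements of a have the
  same row as a, so f x is at least k! k^(-k/2) n^(-k/2) times the row sum. Since k! >= (k/e)^k, the
  row sum is at most (4e)^k (n/k)^(k/2) times the norm of f.
*)
theory Submission
  imports Defs "HOL-Combinatorics.Permutations"
begin

section \<open>Monomials of index tuples and the spread matrix\<close>

definition monomial_value :: "(nat \<Rightarrow>\<^sub>0 nat) \<Rightarrow> (nat \<Rightarrow> real) \<Rightarrow> real" where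
  "monomial_value m x = (\<Prod>i\<in>Poly_Mapping.keys m. x i ^ expo m i)"

definition index_monomial :: "nat \<Rightarrow> (nat \<Rightarrow> nat) \<Rightarrow> (nat \<Rightarrow>\<^sub>0 nat)" where
  "index_monomial k a = (\<Sum>j<k. Poly_Mapping.single (a j) 1)"

text \<open>The matrix positions whose entries contribute to the coefficient of \<open>m\<close>
  when the quadratic form is taken at a tensor power.\<close>

definition splittings :: "nat \<Rightarrow> nat \<Rightarrow> (nat \<Rightarrow>\<^sub>0 nat) \<Rightarrow> ((nat \<Rightarrow> nat) \<times> (nat \<Rightarrow> nat)) set" where
  "splittings n k m = {p \<in> multi_indices n k \<times> multi_indices n k.
     index_monomial k (fst p) + index_monomial k (snd p) = m}"

text \<open>Because the entry sees \<open>a\<close> and \<open>b\<close> only through their product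
  monomial, symmetry and invariance under rearranging \<open>a\<close> come for free.\<close>

definition spread_matrix :: "nat \<Rightarrow> nat \<Rightarrow> rpoly \<Rightarrow> (nat \<Rightarrow> nat) \<Rightarrow> (nat \<Rightarrow> nat) \<Rightarrow> real" where
  "spread_matrix n k f a b = (let m = index_monomial k a + index_monomial k b
     in coeff f m / real (card (splittings n k m)))"

lemma eval_poly_monomial_value:
  "eval_poly f x = (\<Sum>m\<in>Poly_Mapping.keys f. coeff f m * monomial_value m x)"
  by (simp add: eval_poly_def monomial_value_def)

lemma monomial_value_superset:
  assumes "finite A" "Poly_Mapping.keys m \<subseteq> A"
  shows "monomial_value m x = (\<Prod>i\<in>A. x i ^ expo m i)"
  unfolding monomial_value_def
  by (rule prod.mono_neutral_left) (use assms in \<open>auto simp: in_keys_iff\<close>)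

lemma monomial_value_add:
  "monomial_value (m + m') x = monomial_value m x * monomial_value m' x"
proof -
  let ?A = "Poly_Mapping.keys m \<union> Poly_Mapping.keys m'"
  have "Poly_Mapping.keys (m + m') \<subseteq> ?A"
    by (rule Poly_Mapping.keys_add)
  then show ?thesis
    by (simp add: monomial_value_superset[of ?A] lookup_add power_add prod.distrib)
qed

lemma monomial_value_index_monomial:
  "monomial_value (index_monomial k a) x = tensor_power k x a"
proof (induction k)
  case 0
  then show ?case
    by (simp add: index_monomial_def tensor_power_def monomial_value_def)
next
  case (Suc k)
  have "monomial_value (Poly_Mapping.single (a k) 1) x = x (a k)"
    by (simp add: monomial_value_def)
  with Suc show ?case
    by (simp add: index_monomial_def tensor_power_def monomial_value_add)
qed

section \<open>Tensor powers and quadratic forms on the sphere\<close>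

lemma finite_multi_indices [simp]: "finite (multi_indices n k)"
  by (simp add: multi_indices_def finite_PiE)

lemma tensor_power_mono:
  assumes "\<And>j. j < k \<Longrightarrow> c \<le> x (a j)" "0 \<le> c"
  shows "c ^ k \<le> tensor_power k x a"
proof -
  have "(\<Prod>j<k. c) \<le> (\<Prod>j<k. x (a j))"
    by (rule prod_mono) (use assms in auto)
  then show ?thesis
    by (simp add: tensor_power_def)
qed

text \<open>The sum of squares over all tuples factors into \<open>k\<close> equal sums. Hence the
  tensor power of a unit vector lies on the unit sphere.\<close>

lemma L2_set_tensor_power:
  "L2_set (tensor_power k x) (multi_indices n k) = L2_set x {..<n} ^ k"
proof -
  have "(\<Sum>a\<in>multi_indices n k. (tensor_power k x a)\<^sup>2) = (\<Prod>j<k. \<Sum>i<n. (x i)\<^sup>2)"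
    unfolding multi_indices_def tensor_power_def
    by (subst prod_sum_PiE) (auto simp: prod_power_distrib)
  then show ?thesis
    by (simp add: L2_set_def real_sqrt_power)
qed

text \<open>The suprema in \<open>Lambda\<close> are over reals, so they bound their elements only
  once boundedness is known. Coordinates of a unit vector are at most 1 in absolute value.\<close>

lemma bdd_above_quad_form:
  assumes "finite I"
  shows "bdd_above (quad_form I M ` unit_sphere I)"
proof (rule bdd_aboveI2)
  fix z assume z: "z \<in> unit_sphere I"
  have le1: "\<bar>z a\<bar> \<le> 1" if "a \<in> I" for a
  proof -
    have "L2_set (\<lambda>i. \<bar>z i\<bar>) I = 1"
      using z by (simp add: unit_sphere_def L2_set_def)
    then show ?thesis
      using member_le_L2_set[OF assms that, of "\<lambda>i. \<bar>z i\<bar>"] by simp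
  qed
  have "z a * M a b * z b \<le> \<bar>M a b\<bar>" if "a \<in> I" "b \<in> I" for a b
  proof -
    have "z a * M a b * z b \<le> (\<bar>z a\<bar> * \<bar>z b\<bar>) * \<bar>M a b\<bar>"
      by (metis abs_ge_self abs_mult mult.assoc mult.commute)
    also have "\<dots> \<le> 1 * \<bar>M a b\<bar>"
      using le1[OF that(1)] le1[OF that(2)] by (intro mult_right_mono mult_le_one) auto
    finally show ?thesis by simp
  qed
  then show "quad_form I M z \<le> (\<Sum>a\<in>I. \<Sum>b\<in>I. \<bar>M a b\<bar>)"
    unfolding quad_form_def by (intro sum_mono) auto
qed

text \<open>The inequality 2 z_a z_b <= z_a^2 + z_b^2 splits the form into a row part and a column
  part, which agree by symmetry.\<close>

lemma schur_test:
  assumes sym: "\<And>a b. a \<in> I \<Longrightarrow> b \<in> I \<Longrightarrow> M a b = M b a"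
    and nonneg: "\<And>a b. 0 \<le> M a b"
    and row: "\<And>a. a \<in> I \<Longrightarrow> (\<Sum>b\<in>I. M a b) \<le> K"
    and z: "z \<in> unit_sphere I"
  shows "quad_form I M z \<le> K"
proof -
  have z2: "(\<Sum>a\<in>I. (z a)\<^sup>2) = 1"
    using z by (simp add: unit_sphere_def L2_set_def)
  have entry: "z a * M a b * z b \<le> M a b * (z a)\<^sup>2 / 2 + M a b * (z b)\<^sup>2 / 2" for a b
  proof -
    have "0 \<le> M a b * (z a - z b)\<^sup>2" using nonneg by simp
    then show ?thesis by (simp add: power2_eq_square algebra_simps)
  qed
  have "quad_form I M z \<le> (\<Sum>a\<in>I. \<Sum>b\<in>I. M a b * (z a)\<^sup>2 / 2 + M a b * (z b)\<^sup>2 / 2)"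
    unfolding quad_form_def by (intro sum_mono entry)
  also have "\<dots> = (\<Sum>a\<in>I. \<Sum>b\<in>I. M a b * (z a)\<^sup>2 / 2) + (\<Sum>a\<in>I. \<Sum>b\<in>I. M a b * (z b)\<^sup>2 / 2)"
    by (simp add: sum.distrib)
  also have "(\<Sum>a\<in>I. \<Sum>b\<in>I. M a b * (z b)\<^sup>2 / 2) = (\<Sum>a\<in>I. \<Sum>b\<in>I. M a b * (z a)\<^sup>2 / 2)"
    by (subst sum.swap) (auto intro!: sum.cong simp: sym)
  also have "(\<Sum>a\<in>I. \<Sum>b\<in>I. M a b * (z a)\<^sup>2 / 2) + (\<Sum>a\<in>I. \<Sum>b\<in>I. M a b * (z a)\<^sup>2 / 2)
      = (\<Sum>a\<in>I. (\<Sum>b\<in>I. M a b) * (z a)\<^sup>2)"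
    by (simp add: sum_distrib_right flip: sum.distrib)
  also have "\<dots> \<le> (\<Sum>a\<in>I. K * (z a)\<^sup>2)"
    by (intro sum_mono mult_right_mono row) auto
  also have "\<dots> = K"
    using z2 by (simp flip: sum_distrib_left)
  finally show ?thesis .
qed

section \<open>The norm of a polynomial\<close>

lemma bdd_above_eval_poly:
  assumes "variate n f"
  shows "bdd_above ((\<lambda>x. \<bar>eval_poly f x\<bar>) ` unit_sphere {..<n})"
proof (rule bdd_aboveI2)
  fix x :: "nat \<Rightarrow> real" assume x: "x \<in> unit_sphere {..<n}"
  have le1: "\<bar>x i\<bar> \<le> 1" if "i < n" for i
  proof -
    have "L2_set (\<lambda>i. \<bar>x i\<bar>) {..<n} = 1"
      using x by (simp add: unit_sphere_def L2_set_def)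
    then show ?thesis
      using member_le_L2_set[of "{..<n}" i "\<lambda>i. \<bar>x i\<bar>"] that by simp
  qed
  have "\<bar>coeff f m * monomial_value m x\<bar> \<le> \<bar>coeff f m\<bar>" if "m \<in> Poly_Mapping.keys f" for m
  proof -
    have "\<bar>monomial_value m x\<bar> \<le> 1"
      unfolding monomial_value_def abs_prod power_abs
      by (rule prod_le_1) (use assms that le1 in \<open>auto simp: variate_def intro!: power_le_one\<close>)
    then show ?thesis
      by (simp add: abs_mult mult_left_le)
  qed
  then show "\<bar>eval_poly f x\<bar> \<le> (\<Sum>m\<in>Poly_Mapping.keys f. \<bar>coeff f m\<bar>)"
    unfolding eval_poly_monomial_value by (intro order.trans[OF sum_abs] sum_mono) auto
qed

lemma eval_poly_scale:
  assumes "homogeneous d f"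
  shows "eval_poly f (\<lambda>i. t * x i) = t ^ d * eval_poly f x"
proof -
  have "monomial_value m (\<lambda>i. t * x i) = t ^ d * monomial_value m x"
    if "m \<in> Poly_Mapping.keys f" for m
    using assms that
    by (auto simp: monomial_value_def homogeneous_def power_mult_distrib prod.distrib
        simp flip: power_sum)
  then show ?thesis
    by (simp add: eval_poly_monomial_value sum_distrib_left mult.left_commute)
qed

lemma L2_set_basis_vector:
  assumes "n \<ge> 1"
  shows "L2_set (\<lambda>i::nat. if i = 0 then 1 else 0) {..<n} = 1"
proof -
  have "(\<Sum>i<n. (if i = 0 then 1 else 0 :: real)\<^sup>2) = (\<Sum>i<n. if i = 0 then 1 else 0)"
    by (intro sum.cong) auto
  then show ?thesis
    using assms by (simp add: L2_set_def)
qed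

text \<open>For \<open>n \<ge> 1\<close> the sphere contains a basis vector, so the supremum is over
  a nonempty set of absolute values.\<close>

lemma norm2_nonneg:
  assumes "variate n f" "n \<ge> 1"
  shows "0 \<le> norm2 n f"
proof -
  have "(\<lambda>i. if i = 0 then 1 else 0) \<in> unit_sphere {..<n}"
    using L2_set_basis_vector[OF assms(2)] by (simp add: unit_sphere_def)
  from cSUP_upper[OF this bdd_above_eval_poly[OF assms(1)]] show ?thesis
    by (simp add: norm2_def order.trans[OF abs_ge_zero])
qed

text \<open>Normalise \<open>x\<close> and use homogeneity. Only an upper bound \<open>c\<close> on
  the norm is asked for, so the exact norm of a test vector need not be computed.\<close>

lemma eval_poly_le_norm2:
  assumes f: "variate n f" "homogeneous d f" and L: "0 < L2_set x {..<n}" "L2_set x {..<n} \<le> c"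
  shows "eval_poly f x \<le> c ^ d * norm2 n f"
proof -
  define L where "L = L2_set x {..<n}"
  have L0: "L > 0" using L L_def by simp
  then have n: "n \<ge> 1" by (cases n) (auto simp: L_def)
  have "L2_set (\<lambda>i. inverse L * x i) {..<n} = inverse L * L"
    unfolding L_def by (rule L2_set_right_distrib[symmetric]) (use L in auto)
  then have "(\<lambda>i. inverse L * x i) \<in> unit_sphere {..<n}"
    using L0 by (simp add: unit_sphere_def)
  from cSUP_upper[OF this bdd_above_eval_poly[OF f(1)]]
  have "eval_poly f (\<lambda>i. inverse L * x i) \<le> norm2 n f"
    by (simp add: norm2_def)
  then have "L ^ d * eval_poly f (\<lambda>i. inverse L * x i) \<le> L ^ d * norm2 n f"
    using L0 by (intro mult_left_mono) auto
  moreover have "eval_poly f x = L ^ d * eval_poly f (\<lambda>i. inverse L * x i)"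
    using L0 eval_poly_scale[OF f(2), of L "\<lambda>i. inverse L * x i"] by (simp add: mult.assoc[symmetric])
  moreover have "L ^ d * norm2 n f \<le> c ^ d * norm2 n f"
    using L L0 norm2_nonneg[OF f(1) n] by (intro mult_right_mono power_mono) (auto simp: L_def)
  ultimately show ?thesis by linarith
qed

section \<open>The spread matrix represents the polynomial\<close>

lemma finite_splittings [simp]: "finite (splittings n k m)"
  by (simp add: splittings_def)

lemma sum_lessThan_double:
  fixes g :: "nat \<Rightarrow> 'a::comm_monoid_add"
  shows "(\<Sum>j<2 * k. g j) = (\<Sum>j<k. g j) + (\<Sum>j<k. g (k + j))"
proof -
  have "(\<Sum>j<2 * k. g j) = (\<Sum>j<k. g j) + (\<Sum>j=k..<k + k. g j)"
    by (simp add: lessThan_atLeast0 sum.atLeastLessThan_concat mult_2)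
  also have "(\<Sum>j=k..<k + k. g j) = (\<Sum>j<k. g (k + j))"
    using sum.shift_bounds_nat_ivl[of g 0 k k] by (simp add: lessThan_atLeast0 add.commute)
  finally show ?thesis .
qed

text \<open>A multilinear monomial of degree \<open>2 * k\<close> is a product of
  \<open>2 * k\<close> distinct variables; any enumeration of them can be cut in half. This keeps
  the denominators in \<open>spread_matrix\<close> nonzero on the support of
  \<open>f\<close>.\<close>

lemma splittings_nonempty:
  assumes keys: "Poly_Mapping.keys m \<subseteq> {..<n}"
    and deg: "(\<Sum>i\<in>Poly_Mapping.keys m. expo m i) = 2 * k"
    and lin: "\<And>i. expo m i \<le> 1"
  shows "splittings n k m \<noteq> {}"
proof -
  let ?K = "Poly_Mapping.keys m"
  have one: "expo m i = (if i \<in> ?K then 1 else 0)" for i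
    using lin[of i] by (auto simp: in_keys_iff)
  have "card ?K = 2 * k"
    using deg by (simp add: one)
  then obtain h where h: "bij_betw h {..<2 * k} ?K"
    using ex_bij_betw_nat_finite[of ?K] by (auto simp: lessThan_atLeast0)
  have "m = (\<Sum>i\<in>?K. Poly_Mapping.single i 1)"
    by (rule poly_mapping_eqI) (simp add: lookup_sum lookup_single one when_def)
  also have "\<dots> = (\<Sum>j<2 * k. Poly_Mapping.single (h j) 1)"
    by (rule sum.reindex_bij_betw[OF h, symmetric])
  finally have m: "m = (\<Sum>j<k. Poly_Mapping.single (h j) 1) + (\<Sum>j<k. Poly_Mapping.single (h (k + j)) 1)"
    by (simp only: sum_lessThan_double)
  have hn: "h j < n" if "j < 2 * k" for j
    using bij_betwE[OF h] keys that by auto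
  \<comment> \<open>Restriction makes both halves extensional, as membership in
    \<open>multi_indices\<close> demands.\<close>
  have "(restrict h {..<k}, restrict (\<lambda>j. h (k + j)) {..<k}) \<in> splittings n k m"
    using hn unfolding splittings_def multi_indices_def index_monomial_def m
    by (simp add: restrict_PiE_iff)
  then show ?thesis by auto
qed

lemma spread_matrix_nonneg: "nonneg_coeffs f \<Longrightarrow> 0 \<le> spread_matrix n k f a b"
  by (simp add: spread_matrix_def nonneg_coeffs_def Let_def)

text \<open>Group the pairs by product monomial: each group has as many members as the denominator
  of its entries.\<close>

lemma quad_form_spread_matrix:
  assumes "variate n f" "homogeneous (2 * k) f" "multilinear f"
  shows "quad_form (multi_indices n k) (spread_matrix n k f) (tensor_power k x) = eval_poly f x"
proof -
  let ?I = "multi_indices n k"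
  define \<mu> where "\<mu> p = index_monomial k (fst p) + index_monomial k (snd p)" for p
  define g where "g m = monomial_value m x * coeff f m / real (card (splittings n k m))" for m
  \<comment> \<open>Large enough for both the grouping and the sum defining
    \<open>eval_poly\<close>; monomials outside the support have coefficient 0.\<close>
  let ?R = "\<mu> ` (?I \<times> ?I) \<union> Poly_Mapping.keys f"
  have "quad_form ?I (spread_matrix n k f) (tensor_power k x) = (\<Sum>p\<in>?I \<times> ?I. g (\<mu> p))"
    unfolding quad_form_def sum.cartesian_product
    by (intro sum.cong) (auto simp: g_def \<mu>_def spread_matrix_def Let_def monomial_value_add
        monomial_value_index_monomial)
  also have "\<dots> = (\<Sum>m\<in>?R. real (card {p \<in> ?I \<times> ?I. \<mu> p = m}) * g m)"
    by (rule sum_fun_comp) auto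
  also have "\<dots> = (\<Sum>m\<in>?R. coeff f m * monomial_value m x)"
  proof (intro sum.cong refl)
    fix m
    have "{p \<in> ?I \<times> ?I. \<mu> p = m} = splittings n k m"
      by (simp add: splittings_def \<mu>_def)
    moreover have "card (splittings n k m) \<noteq> 0" if "m \<in> Poly_Mapping.keys f"
      using splittings_nonempty[of m n k] assms that
      by (auto simp: variate_def homogeneous_def multilinear_def)
    ultimately show "real (card {p \<in> ?I \<times> ?I. \<mu> p = m}) * g m = coeff f m * monomial_value m x"
      by (cases "m \<in> Poly_Mapping.keys f") (auto simp: g_def in_keys_iff)
  qed
  also have "\<dots> = eval_poly f x"
    unfolding eval_poly_monomial_value
    by (rule sum.mono_neutral_right) (auto simp: in_keys_iff)
  finally show ?thesis .
qed

lemma spread_matrix_symmetric: "spread_matrix n k f a b = spread_matrix n k f b a"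
  by (simp add: spread_matrix_def add.commute)

lemma matrix_rep_spread_matrix:
  assumes "variate n f" "homogeneous (2 * k) f" "multilinear f"
  shows "matrix_rep n (2 * k) f (spread_matrix n k f)"
  using quad_form_spread_matrix[OF assms] spread_matrix_symmetric by (simp add: matrix_rep_def)

text \<open>A repeated index gives its variable an exponent of at least 2, so the product monomial
  is outside the support of \<open>f\<close>.\<close>

lemma spread_matrix_noninjective:
  assumes "multilinear f" "\<not> inj_on a {..<k}"
  shows "spread_matrix n k f a b = 0"
proof -
  let ?m = "index_monomial k a + index_monomial k b"
  from assms(2) obtain i j where ij: "i < k" "j < k" "i \<noteq> j" "a i = a j"
    by (auto simp: inj_on_def)
  have "2 = (\<Sum>l\<in>{i, j}. expo (Poly_Mapping.single (a l) 1) (a i))"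
    using ij by simp
  also have "\<dots> \<le> (\<Sum>l<k. expo (Poly_Mapping.single (a l) 1) (a i))"
    by (rule sum_mono2) (use ij in auto)
  also have "\<dots> \<le> expo ?m (a i)"
    by (simp add: index_monomial_def lookup_add lookup_sum)
  finally have "\<not> expo ?m (a i) \<le> 1"
    by simp
  then have "?m \<notin> Poly_Mapping.keys f"
    using assms(1) by (auto simp only: multilinear_def)
  then show ?thesis
    by (simp add: spread_matrix_def in_keys_iff)
qed

section \<open>Rearrangements and the row sums\<close>

definition rearrangements :: "nat \<Rightarrow> (nat \<Rightarrow> nat) \<Rightarrow> (nat \<Rightarrow> nat) set" where
  "rearrangements k a = (\<lambda>\<pi>. restrict (a \<circ> \<pi>) {..<k}) ` {\<pi>. \<pi> permutes {..<k}}"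

text \<open>Injectivity of \<open>a\<close> recovers a permutation from its rearrangement on
  \<open>{..<k}\<close>; elsewhere every permutation is the identity.\<close>

lemma card_rearrangements:
  assumes "inj_on a {..<k}"
  shows "card (rearrangements k a) = fact k"
proof -
  have "inj_on (\<lambda>\<pi>. restrict (a \<circ> \<pi>) {..<k}) {\<pi>. \<pi> permutes {..<k}}"
  proof (rule inj_onI, clarsimp)
    fix p q assume p: "p permutes {..<k}" and q: "q permutes {..<k}"
      and eq: "restrict (a \<circ> p) {..<k} = restrict (a \<circ> q) {..<k}"
    show "p = q"
    proof
      fix j
      show "p j = q j"
      proof (cases "j < k")
        case True
        then have "a (p j) = a (q j)"
          using fun_cong[OF eq, of j] by simp
        moreover have "p j \<in> {..<k}" "q j \<in> {..<k}"
          using True permutes_in_image[OF p, of j] permutes_in_image[OF q, of j] by auto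
        ultimately show ?thesis
          using assms by (auto dest: inj_onD)
      next
        case False
        then show ?thesis
          using permutes_not_in[OF p, of j] permutes_not_in[OF q, of j] by simp
      qed
    qed
  qed
  then show ?thesis
    by (simp add: rearrangements_def card_image card_permutations)
qed

lemma rearrangements_subset:
  assumes "a \<in> multi_indices n k"
  shows "rearrangements k a \<subseteq> multi_indices n k"
proof -
  have "a (\<pi> j) < n" if "\<pi> permutes {..<k}" "j < k" for \<pi> j
    using assms that permutes_in_image[of \<pi> "{..<k}" j] by (auto simp: multi_indices_def)
  then show ?thesis
    by (auto simp: rearrangements_def multi_indices_def simp del: restrict_apply
        intro!: restrict_PiE_iff[THEN iffD2])
qed

lemma index_monomial_rearrangement:
  assumes "a' \<in> rearrangements k a"
  shows "index_monomial k a' = index_monomial k a"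
proof -
  from assms obtain \<pi> where \<pi>: "\<pi> permutes {..<k}" "a' = restrict (a \<circ> \<pi>) {..<k}"
    by (auto simp: rearrangements_def)
  show ?thesis
    using sum.permute[OF \<pi>(1), of "\<lambda>j. Poly_Mapping.single (a j) (1::nat)"]
    by (simp add: index_monomial_def \<pi>(2))
qed

lemma rearrangement_image:
  assumes "a' \<in> rearrangements k a" "j < k"
  shows "a' j \<in> a ` {..<k}"
proof -
  from assms obtain \<pi> where \<pi>: "\<pi> permutes {..<k}" "a' = restrict (a \<circ> \<pi>) {..<k}"
    by (auto simp: rearrangements_def)
  show ?thesis
    using permutes_in_image[OF \<pi>(1), of j] assms(2) by (simp add: \<pi>(2))
qed

text \<open>The value of \<open>f\<close> at the test vector lies between a partial sum of the
  quadratic form and a multiple of the norm. The factor \<open>4 ^ k\<close> is the vector's norm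
  bound 2 raised to the degree; the square roots undo its coordinates.\<close>

lemma row_sum_spread_matrix:
  assumes f: "variate n f" "homogeneous (2 * k) f" "multilinear f" "nonneg_coeffs f"
    and n: "n \<ge> 1" and a: "a \<in> multi_indices n k"
  shows "fact k * (\<Sum>b\<in>multi_indices n k. spread_matrix n k f a b)
    \<le> 4 ^ k * sqrt (real k) ^ k * sqrt (real n) ^ k * norm2 n f"
proof (cases "inj_on a {..<k}")
  case False
  then show ?thesis
    using norm2_nonneg[OF f(1) n] by (simp add: spread_matrix_noninjective[OF f(3)])
next
  case inj: True
  let ?I = "multi_indices n k" and ?M = "spread_matrix n k f"
  \<comment> \<open>\<open>u\<close> favours the indices of \<open>a\<close>, while \<open>v\<close>
    gives every tuple \<open>b\<close> a positive weight.\<close>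
  define u where "u i = (if i \<in> a ` {..<k} then 1 / sqrt (real k) else 0)" for i
  define v where "v = (\<lambda>i::nat. 1 / sqrt (real n))"
  define x where "x i = u i + v i" for i
  have u0: "0 \<le> u i" and v0: "0 < v i" for i
    using n by (auto simp: u_def v_def)
  have an: "a ` {..<k} \<subseteq> {..<n}"
    using a by (auto simp: multi_indices_def)
  have "L2_set u {..<n} = sqrt (\<Sum>i<n. (u i)\<^sup>2)"
    by (simp add: L2_set_def)
  also have "(\<Sum>i<n. (u i)\<^sup>2) = (\<Sum>i\<in>a ` {..<k}. 1 / real k)"
    by (rule sum.mono_neutral_cong_right) (use an in \<open>auto simp: u_def power_divide\<close>)
  \<comment> \<open>The sum is 1, except that it is 0 when \<open>k = 0\<close>.\<close>
  also have "\<dots> \<le> 1"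
    by (simp add: card_image[OF inj])
  finally have Lu: "L2_set u {..<n} \<le> 1" by simp
  have Lv: "L2_set v {..<n} = 1"
    using n by (simp add: L2_set_def v_def power_divide)
  have "L2_set x {..<n} \<le> 2"
    unfolding x_def using L2_set_triangle_ineq[of u v "{..<n}"] Lu Lv by simp
  moreover have "0 < L2_set x {..<n}"
  proof -
    have "0 < x 0" using u0[of 0] v0[of 0] by (simp add: x_def)
    also have "x 0 \<le> L2_set x {..<n}" by (rule member_le_L2_set) (use n in auto)
    finally show ?thesis .
  qed
  ultimately have upper: "eval_poly f x \<le> 2 ^ (2 * k) * norm2 n f"
    by (intro eval_poly_le_norm2[OF f(1,2)]) auto

  let ?s = "(1 / sqrt (real k)) ^ k" and ?t = "(1 / sqrt (real n)) ^ k"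
  have x0: "0 \<le> tensor_power k x b" for b
    unfolding tensor_power_def
    by (rule prod_nonneg) (simp add: x_def u0 v0 add_nonneg_pos less_imp_le)
  have tb: "?t \<le> tensor_power k x b" for b
    by (rule tensor_power_mono) (use u0 in \<open>auto simp: x_def v_def\<close>)
  have ta: "?s \<le> tensor_power k x a'" if "a' \<in> rearrangements k a" for a'
  proof (rule tensor_power_mono)
    fix j assume "j < k"
    from rearrangement_image[OF that this] show "1 / sqrt (real k) \<le> x (a' j)"
      using v0[of "a' j"] by (auto simp: x_def u_def)
  qed auto
  \<comment> \<open>The factor \<open>fact k\<close> becomes a sum over the rearrangements of
    \<open>a\<close>.\<close>
  have "fact k * (?s * ?t * (\<Sum>b\<in>?I. ?M a b))
      = (\<Sum>a'\<in>rearrangements k a. \<Sum>b\<in>?I. ?s * ?M a b * ?t)"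
    by (simp add: card_rearrangements[OF inj] sum_distrib_left sum_distrib_right mult_ac)
  also have "\<dots> \<le> (\<Sum>a'\<in>rearrangements k a. \<Sum>b\<in>?I. tensor_power k x a' * ?M a' b * tensor_power k x b)"
  proof (intro sum_mono)
    fix a' b assume a': "a' \<in> rearrangements k a"
    have "?M a' b = ?M a b"
      using index_monomial_rearrangement[OF a'] by (simp add: spread_matrix_def)
    then show "?s * ?M a b * ?t \<le> tensor_power k x a' * ?M a' b * tensor_power k x b"
      using ta[OF a'] tb[of b] x0[of a'] spread_matrix_nonneg[OF f(4), of n k a b]
      by (auto intro!: mult_mono)
  qed
  \<comment> \<open>The remaining rows contribute only nonnegative terms.\<close>
  also have "\<dots> \<le> quad_form ?I ?M (tensor_power k x)"
    unfolding quad_form_def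
    by (rule sum_mono2) (use rearrangements_subset[OF a] x0 spread_matrix_nonneg[OF f(4)] in
        \<open>auto intro!: sum_nonneg mult_nonneg_nonneg\<close>)
  also have "\<dots> = eval_poly f x"
    by (rule quad_form_spread_matrix[OF f(1-3)])
  also note upper
  finally have "fact k * (?s * ?t * (\<Sum>b\<in>?I. ?M a b)) \<le> 4 ^ k * norm2 n f"
    by (simp add: power_mult)
  then have scaled: "(fact k * (?s * ?t * (\<Sum>b\<in>?I. ?M a b))) * (sqrt (real k) ^ k * sqrt (real n) ^ k)
      \<le> (4 ^ k * norm2 n f) * (sqrt (real k) ^ k * sqrt (real n) ^ k)"
    by (rule mult_right_mono) simp
  \<comment> \<open>For \<open>k = 0\<close> the base \<open>1 / sqrt 0\<close> is 0, but its zeroth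
    power is still 1.\<close>
  have cancel: "?s * sqrt (real k) ^ k = 1" "?t * sqrt (real n) ^ k = 1"
    using n by (cases "k = 0"; simp flip: power_mult_distrib)+
  have "fact k * (\<Sum>b\<in>?I. ?M a b)
      = (fact k * (\<Sum>b\<in>?I. ?M a b)) * ((?s * sqrt (real k) ^ k) * (?t * sqrt (real n) ^ k))"
    by (simp only: cancel mult_1_right)
  also have "\<dots> = (fact k * (?s * ?t * (\<Sum>b\<in>?I. ?M a b))) * (sqrt (real k) ^ k * sqrt (real n) ^ k)"
    by (simp only: mult_ac)
  also note scaled
  finally show ?thesis
    by (simp only: mult_ac)
qed

section \<open>Constants and the final bound\<close>

text \<open>The left side over \<open>fact k\<close> is a single term of the exponential series at
  \<open>k\<close>.\<close>

lemma power_self_le_exp_fact: "real k ^ k \<le> exp 1 ^ k * fact k"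
proof -
  have "summable (\<lambda>i. real k ^ i / fact i)"
    using summable_exp[of "real k"] by (simp add: field_simps)
  then have "(\<Sum>i\<in>{k}. real k ^ i / fact i) \<le> suminf (\<lambda>i. real k ^ i / fact i)"
    by (rule sum_le_suminf) auto
  then have "real k ^ k / fact k \<le> exp (real k)"
    by (simp add: exp_def divide_inverse mult.commute)
  then show ?thesis
    by (simp add: divide_le_eq exp_of_nat_mult[of k "1::real", simplified])
qed

text \<open>The infimum is below each of its members only if they are bounded below. All
  representations agree at the tensor power of a basis vector \<open>e\<close>, so
  \<open>eval_poly f e\<close> is a common lower bound.\<close>

lemma Lambda_le:
  assumes M: "matrix_rep n d f M"
    and K: "\<And>z. z \<in> unit_sphere (multi_indices n (d div 2)) \<Longrightarrow>
      quad_form (multi_indices n (d div 2)) M z \<le> K"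
    and n: "n \<ge> 1"
  shows "Lambda n d f \<le> K"
proof -
  let ?I = "multi_indices n (d div 2)"
  define e where "e i = (if i = 0 then 1 else 0 :: real)" for i :: nat
  have "L2_set e {..<n} = 1"
    using L2_set_basis_vector[OF n] by (simp add: e_def[abs_def])
  then have e: "tensor_power (d div 2) e \<in> unit_sphere ?I"
    by (simp add: unit_sphere_def L2_set_tensor_power)
  have "eval_poly f e \<le> (SUP z\<in>unit_sphere ?I. quad_form ?I M' z)" if "matrix_rep n d f M'" for M'
    using cSUP_upper[OF e bdd_above_quad_form[OF finite_multi_indices, of _ _ M']] that
    by (simp add: matrix_rep_def)
  then have "bdd_below ((\<lambda>M. SUP z\<in>unit_sphere ?I. quad_form ?I M z) ` {M. matrix_rep n d f M})"
    by (intro bdd_belowI2[of _ "eval_poly f e"]) auto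
  then have "Lambda n d f \<le> (SUP z\<in>unit_sphere ?I. quad_form ?I M z)"
    unfolding Lambda_def by (rule cINF_lower) (use M in simp)
  also have "\<dots> \<le> K"
    by (rule cSUP_least) (use e K in auto)
  finally show ?thesis .
qed

text \<open>By the bound on \<open>k ^ k\<close> the base of the constant is
  \<open>4 * exp 1 * sqrt 2\<close>, at most 24 and so below \<open>64 = 2 ^ 6\<close>. For
  \<open>k = 0\<close> both sides are 1.\<close>

lemma four_sqrt_le:
  "4 ^ k * sqrt (real k) ^ k * sqrt (real n) ^ k / fact k
    \<le> 2 powr (3 * real (2 * k)) * (root 4 (real n) ^ (2 * k) / root 4 (real (2 * k)) ^ (2 * k))"
proof (cases "k = 0")
  case False
  let ?s = "sqrt (real k)" and ?t = "sqrt (real n)"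
  have s: "?s > 0" using False by simp
  have r: "root 4 y ^ (2 * k) = sqrt y ^ k" if "0 \<le> y" for y
  proof -
    have "root 4 y = sqrt (sqrt y)"
      using real_root_mult_exp[of 2 2 y] by (simp add: sqrt_def)
    then show ?thesis
      using that by (simp add: power_mult)
  qed
  have p: "2 powr (3 * real (2 * k)) = 64 ^ k"
  proof -
    have "2 powr (3 * real (2 * k)) = 2 powr real (6 * k)" by simp
    also have "\<dots> = 2 ^ (6 * k)" by (rule powr_realpow) simp
    finally show ?thesis by (simp add: power_mult)
  qed
  have kk: "(?s * ?s) ^ k \<le> exp 1 ^ k * fact k"
    using power_self_le_exp_fact[of k] by simp
  have "4 * exp 1 * sqrt 2 \<le> (64::real)"
  proof -
    have "sqrt 2 \<le> (2::real)" by (rule real_le_lsqrt) auto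
    then have "4 * exp 1 * sqrt 2 \<le> 4 * 3 * (2::real)"
      using exp_le by (intro mult_mono) auto
    then show ?thesis by simp
  qed
  then have c: "(4 * exp 1 * sqrt 2) ^ k \<le> (64::real) ^ k"
    by (intro power_mono) auto
  \<comment> \<open>Here \<open>sqrt 2 * ?s\<close> is the square root of \<open>2 * k\<close>, so
    its \<open>k\<close>-th power is the denominator
    \<open>root 4 (real (2 * k)) ^ (2 * k)\<close>.\<close>
  have "4 ^ k * ?s ^ k * ?t ^ k * (sqrt 2 * ?s) ^ k = (4 * sqrt 2) ^ k * ?t ^ k * (?s * ?s) ^ k"
    by (simp only: power_mult_distrib mult_ac)
  also have "\<dots> \<le> (4 * sqrt 2) ^ k * ?t ^ k * (exp 1 ^ k * fact k)"
    by (intro mult_left_mono kk) auto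
  also have "\<dots> = (4 * exp 1 * sqrt 2) ^ k * ?t ^ k * fact k"
    by (simp only: power_mult_distrib mult_ac)
  also have "\<dots> \<le> 64 ^ k * ?t ^ k * fact k"
    by (intro mult_right_mono c) auto
  finally have "4 ^ k * ?s ^ k * ?t ^ k / fact k \<le> 64 ^ k * ?t ^ k / (sqrt 2 * ?s) ^ k"
    using s by (simp add: divide_le_eq le_divide_eq)
  then show ?thesis
    by (simp only: p r of_nat_0_le_iff) (simp add: real_sqrt_mult)
qed simp

theorem theorem5p14:
  "\<exists>C :: real. \<forall>(n :: nat) (d :: nat) (f :: rpoly).
     n \<ge> 1 \<longrightarrow> even d \<longrightarrow>
     variate n f \<longrightarrow> homogeneous d f \<longrightarrow> multilinear f \<longrightarrow> nonneg_coeffs f \<longrightarrow>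
     Lambda n d f / norm2 n f
       \<le> 2 powr (C * real d) * (root 4 (real n) ^ d / root 4 (real d) ^ d)"
proof (intro exI[of _ 3] allI impI)
  fix n d f
  assume n: "n \<ge> 1" and "even d" and "variate n f" and "homogeneous d f"
    and f: "multilinear f" "nonneg_coeffs f"
  from \<open>even d\<close> obtain k where d: "d = 2 * k" by (auto elim: evenE)
  note f = \<open>variate n f\<close> \<open>homogeneous d f\<close>[unfolded d] f
  let ?B = "4 ^ k * sqrt (real k) ^ k * sqrt (real n) ^ k / fact k"
  have "Lambda n d f \<le> ?B * norm2 n f"
  proof (rule Lambda_le[OF _ _ n])
    show "matrix_rep n d f (spread_matrix n k f)"
      using matrix_rep_spread_matrix[OF f(1-3)] d by simp
  next
    fix z :: "(nat \<Rightarrow> nat) \<Rightarrow> real"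
    assume z: "z \<in> unit_sphere (multi_indices n (d div 2))"
    have "(\<Sum>b\<in>multi_indices n k. spread_matrix n k f a b) \<le> ?B * norm2 n f"
      if "a \<in> multi_indices n k" for a
      using row_sum_spread_matrix[OF f n that] by (simp add: le_divide_eq mult.commute)
    then show "quad_form (multi_indices n (d div 2)) (spread_matrix n k f) z \<le> ?B * norm2 n f"
      using z d spread_matrix_symmetric spread_matrix_nonneg[OF f(4)]
      by (intro schur_test) auto
  qed
  then have "Lambda n d f / norm2 n f \<le> ?B"
    \<comment> \<open>If the norm is 0, the quotient is 0 by convention and \<open>?B\<close> is
      nonnegative.\<close>
    using norm2_nonneg[OF f(1) n] by (cases "norm2 n f = 0") (auto simp: divide_le_eq)
  also note four_sqrt_le[of k n]
  finally show "Lambda n d f / norm2 n f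
      \<le> 2 powr (3 * real d) * (root 4 (real n) ^ d / root 4 (real d) ^ d)"
    by (simp only: d)
qed

end
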